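(* Let $n,k\ge 1$ be integers and let $x\in\mathbb{R}^n$. Then $xx^T\in\mathcal{S}_{n,k}$ if and only if $\|x\|_0\le k$. In particular, $\operatorname{conv}(Q_{n,k})\subseteq\mathcal{S}_{n,k}$.
   Context: $\mathbb{S}^n$ is the space of real symmetric $n\times n$ matrices, and $A\succeq B$ means that $A-B$ is positive semidefinite. For a matrix $X\in\mathbb{S}^n$, $\operatorname{diag}(X)\in\mathbb{S}^n$ is the diagonal matrix with the same diagonal as $X$. $\|x\|_0$ is the number of nonzero entries of $x$. Define $\mathcal{S}_{n,k}=\{X\in\mathbb{S}^n: k\operatorname{diag}(X)\succeq X\succeq 0\}$ and $Q_{n,k}=\{xx^T: x\in\mathbb{R}^n,\ \|x\|_0\le k\}$; $\operatorname{conv}$ denotes convex hull. *)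

theory Defs
  imports "HOL-Analysis.Analysis"
begin

definition sym_mats :: "(real ^ 'n ^ 'n) set" where
  "sym_mats = {X. transpose X = X}"

(* Over the reals, nonnegativity of the quadratic form does not imply symmetry,
   so symmetry is part of the definition. *)
definition psd :: "real ^ 'n ^ 'n \<Rightarrow> bool" where
  "psd X \<longleftrightarrow> X \<in> sym_mats \<and> (\<forall>v. 0 \<le> v \<bullet> (X *v v))"

definition loewner_ge :: "real ^ 'n ^ 'n \<Rightarrow> real ^ 'n ^ 'n \<Rightarrow> bool"  (infix "\<succeq>" 50) where
  "A \<succeq> B \<longleftrightarrow> psd (A - B)"

definition diag_part :: "real ^ 'n ^ 'n \<Rightarrow> real ^ 'n ^ 'n" where
  "diag_part X = (\<chi> i j. if i = j then X $ i $ j else 0)"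

definition l0_norm :: "real ^ 'n \<Rightarrow> nat" where
  "l0_norm x = card {i. x $ i \<noteq> 0}"

definition outer_self :: "real ^ 'n \<Rightarrow> real ^ 'n ^ 'n" where
  "outer_self x = (columnvector x :: real ^ 1 ^ 'n) ** (rowvector x :: real ^ 'n ^ 1)"

definition S_set :: "nat \<Rightarrow> (real ^ 'n ^ 'n) set" where
  "S_set k = {X \<in> sym_mats. real k *\<^sub>R diag_part X \<succeq> X \<and> X \<succeq> 0}"

definition Q_set :: "nat \<Rightarrow> (real ^ 'n ^ 'n) set" where
  "Q_set k = {outer_self x |x. l0_norm x \<le> k}"

end

theory Submission
  imports Defs
begin

text \<open>
  On \<open>x x\<^sup>T\<close> the condition \<open>k diag(X) \<succeq> X\<close> says
  \<open>(\<Sum>i. x\<^sub>i v\<^sub>i)\<^sup>2 \<le> k (\<Sum>i. (x\<^sub>i v\<^sub>i)\<^sup>2)\<close> for all \<open>v\<close>.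
  Cauchy--Schwarz on the support of \<open>x\<close> gives it when the support has at most \<open>k\<close> elements;
  conversely, the choice \<open>v\<^sub>i = 1 / x\<^sub>i\<close> on the support forces this bound.
\<close>

lemma outer_self_nth: "outer_self x $ i $ j = x $ i * x $ j"
  by (simp add: outer_self_def matrix_matrix_mult_def columnvector_def rowvector_def)

lemma outer_self_symmetric: "outer_self x \<in> sym_mats"
  by (simp add: sym_mats_def transpose_def outer_self_nth vec_eq_iff mult.commute)

lemma outer_self_quadratic_form: "v \<bullet> (outer_self x *v v) = (\<Sum>i\<in>UNIV. x $ i * v $ i)\<^sup>2"
  by (simp add: inner_vec_def matrix_vector_mult_def outer_self_nth power2_eq_square
      sum_product sum_distrib_left mult_ac)

lemma diag_part_symmetric: "diag_part X \<in> sym_mats"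
  by (simp add: sym_mats_def transpose_def diag_part_def vec_eq_iff)

lemma diag_part_quadratic_form: "v \<bullet> (diag_part X *v v) = (\<Sum>i\<in>UNIV. X $ i $ i * (v $ i)\<^sup>2)"
  by (simp add: inner_vec_def matrix_vector_mult_def diag_part_def power2_eq_square
      if_distrib [where f = "\<lambda>a. a * _"] mult.left_commute cong: if_cong)

text \<open>Since \<open>psd\<close> includes symmetry, differences and convex combinations of
  symmetric matrices must be shown symmetric; closure under linear combinations settles
  both.\<close>

lemma subspace_sym_mats: "subspace sym_mats"
  by (simp add: subspace_def sym_mats_def transpose_def vec_eq_iff)

lemma psd_outer_self: "psd (outer_self x)"
  by (simp add: psd_def outer_self_symmetric outer_self_quadratic_form)

text \<open>Symmetry and \<open>outer_self x \<succeq> 0\<close> are automatic, the quadratic form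
  being a square. Only the upper Loewner bound remains, and the diagonal entries are the squares of
  the entries of \<open>x\<close>.\<close>

lemma outer_self_mem_S_set_iff:
  "outer_self x \<in> S_set k \<longleftrightarrow>
     (\<forall>v. (\<Sum>i\<in>UNIV. x $ i * v $ i)\<^sup>2 \<le> real k * (\<Sum>i\<in>UNIV. (x $ i * v $ i)\<^sup>2))"
proof -
  have "real k *\<^sub>R diag_part (outer_self x) - outer_self x \<in> sym_mats"
    by (intro subspace_diff subspace_scale subspace_sym_mats diag_part_symmetric outer_self_symmetric)
  moreover have "v \<bullet> ((real k *\<^sub>R diag_part (outer_self x) - outer_self x) *v v)
      = real k * (\<Sum>i\<in>UNIV. (x $ i * v $ i)\<^sup>2) - (\<Sum>i\<in>UNIV. x $ i * v $ i)\<^sup>2" for v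
    by (simp add: matrix_vector_mult_diff_rdistrib inner_diff_right diag_part_quadratic_form
        outer_self_quadratic_form outer_self_nth power_mult_distrib
        power2_eq_square [of "x $ _"] flip: scaleR_matrix_vector_assoc)
  ultimately show ?thesis
    by (simp add: S_set_def loewner_ge_def psd_outer_self outer_self_symmetric psd_def [of "_ - _"])
qed

lemma outer_self_mem_S_set_iff_l0_norm: "outer_self x \<in> S_set k \<longleftrightarrow> l0_norm x \<le> k"
proof
  define A where "A = {i. x $ i \<noteq> 0}"
  assume "outer_self x \<in> S_set k"
  then have "(\<Sum>i\<in>UNIV. x $ i * (\<chi> i. inverse (x $ i)) $ i)\<^sup>2
      \<le> real k * (\<Sum>i\<in>UNIV. (x $ i * (\<chi> i. inverse (x $ i)) $ i)\<^sup>2)"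
    unfolding outer_self_mem_S_set_iff by blast
  \<comment> \<open>As \<open>inverse 0 = 0\<close>, the witness vanishes off the support, so both
    sums count the elements of \<open>A\<close>.\<close>
  moreover have "x $ i * inverse (x $ i) = of_bool (i \<in> A)" for i
    by (simp add: A_def)
  ultimately have "(real (card A))\<^sup>2 \<le> real k * real (card A)"
    by (simp add: of_bool_def if_distrib [where f = "\<lambda>a. a\<^sup>2"] sum.If_cases cong: if_cong)
  then show "l0_norm x \<le> k"
    unfolding power2_eq_square l0_norm_def A_def [symmetric]
    \<comment> \<open>A nonzero \<open>card A\<close> cancels from both sides; for empty support the
      claim is \<open>0 \<le> k\<close>.\<close>
    by (cases "card A = 0") (simp_all only: mult_le_cancel_right of_nat_le_iff of_nat_0_less_iff)
next
  define A where "A = {i. x $ i \<noteq> 0}"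
  assume le: "l0_norm x \<le> k"
  have "(\<Sum>i\<in>UNIV. x $ i * v $ i)\<^sup>2 \<le> real k * (\<Sum>i\<in>UNIV. (x $ i * v $ i)\<^sup>2)" for v :: "real ^ 'a"
  proof -
    \<comment> \<open>Restricting to the support first makes the Cauchy-Schwarz constant
      \<open>card A\<close> instead of the full dimension.\<close>
    have "(\<Sum>i\<in>UNIV. x $ i * v $ i)\<^sup>2 = (\<Sum>i\<in>A. x $ i * v $ i)\<^sup>2"
      by (intro arg_cong [where f = "\<lambda>a. a\<^sup>2"] sum.mono_neutral_right) (auto simp: A_def)
    also have "\<dots> \<le> real (card A) * (\<Sum>i\<in>A. (x $ i * v $ i)\<^sup>2)"
      using sum_squared_le_sum_of_squares [of "\<lambda>i. x $ i * v $ i" A] by (simp add: mult.commute)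
    also have "\<dots> \<le> real k * (\<Sum>i\<in>UNIV. (x $ i * v $ i)\<^sup>2)"
      using le by (intro mult_mono sum_mono2) (auto simp: l0_norm_def A_def intro: sum_nonneg)
    finally show ?thesis .
  qed
  then show "outer_self x \<in> S_set k"
    by (simp add: outer_self_mem_S_set_iff)
qed

text \<open>For fixed \<open>v\<close>, the form \<open>v \<bullet> (X *v v)\<close> is linear in
  \<open>X\<close>, so nonnegative weights preserve its sign.\<close>

lemma convex_psd: "convex {X. psd X}"
proof (rule convexI)
  fix X Y :: "real ^ 'n ^ 'n" and a b :: real
  assume "X \<in> {X. psd X}" "Y \<in> {X. psd X}" "0 \<le> a" "0 \<le> b"
  moreover from this have "a *\<^sub>R X + b *\<^sub>R Y \<in> sym_mats"
    using subspace_sym_mats by (auto simp: psd_def intro: subspace_add subspace_scale)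
  ultimately show "a *\<^sub>R X + b *\<^sub>R Y \<in> {X. psd X}"
    by (simp add: psd_def matrix_vector_mult_add_rdistrib inner_add_right
        flip: scaleR_matrix_vector_assoc)
qed

lemma linear_diag_part: "linear diag_part"
  by (rule linearI) (simp_all add: diag_part_def vec_eq_iff)

text \<open>Both Loewner conditions are preimages of the convex set of psd matrices under linear
  maps. Convexity reduces the hull inclusion to the generators in \<open>Q_set k\<close>.\<close>

lemma convex_S_set: "convex (S_set k)"
proof -
  have "linear (\<lambda>X. real k *\<^sub>R diag_part X - X :: real ^ 'n ^ 'n)"
    by (intro linear_compose_sub linear_compose_scale_right linear_diag_part linear_ident)
  then have "convex ((\<lambda>X. real k *\<^sub>R diag_part X - X) -` {X. psd X} \<inter> {X :: real ^ 'n ^ 'n. psd X})"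
    by (intro convex_Int convex_linear_vimage convex_psd)
  \<comment> \<open>The membership \<open>X \<in> sym_mats\<close> in \<open>S_set\<close> is
    supplied by \<open>psd X\<close>.\<close>
  also have "((\<lambda>X. real k *\<^sub>R diag_part X - X) -` {X. psd X} \<inter> {X :: real ^ 'n ^ 'n. psd X}) = S_set k"
    by (auto simp: S_set_def loewner_ge_def psd_def)
  finally show ?thesis .
qed

theorem lemma2p1:
  fixes k :: nat
  assumes "k \<ge> 1"
  shows "(\<forall>x :: real ^ 'n. outer_self x \<in> S_set k \<longleftrightarrow> l0_norm x \<le> k)
       \<and> convex hull (Q_set k :: (real ^ 'n ^ 'n) set) \<subseteq> S_set k"
proof -
  have "Q_set k \<subseteq> (S_set k :: (real ^ 'n ^ 'n) set)"
    by (auto simp: Q_set_def outer_self_mem_S_set_iff_l0_norm)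
  then show ?thesis
    by (simp add: outer_self_mem_S_set_iff_l0_norm hull_minimal convex_S_set)
qed

end
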